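(* Let $i:Z\hookrightarrow X$ be a closed immersion with open complement $j:U\hookrightarrow X$, and assume the recollement axioms for $(i,j)$. Let $A\in\mathcal C(X)$ and let $\alpha\in H^d(X;A)$ satisfy $j^*\alpha=0\in H^d(U;j^*A)$. Then the set $$\mathrm{forg}^{-1}(\alpha)=\{\widetilde\alpha\in H_Z^d(X;A)\mid\mathrm{forg}(\widetilde\alpha)=\alpha\}$$ is nonempty, and it is a principal homogeneous space (by translation) under the subgroup $\mathrm{im}\bigl(\delta:H^{d-1}(U;j^*A)\to H_Z^d(X;A)\bigr)$. In particular, the supported refinement (the element of $\mathrm{forg}^{-1}(\alpha)$) is unique if and only if $\mathrm{im}\bigl(\delta:H^{d-1}(U;j^*A)\to H_Z^d(X;A)\bigr)=0$. This holds, for example, if $H^{d-1}(U;j^*A)=0$.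
   Context: Setting: to each space $X$ (in a fixed category of spaces with closed immersions, open complements, Cartesian squares and proper morphisms) is attached a stable triangulated category $\mathcal C(X)$ with a symmetric monoidal structure $(\otimes,\mathbf 1_X)$. Each morphism $f:X\to Y$ has exact functors $f^*\dashv f_*$, with $f^*$ symmetric monoidal, so $f^*\mathbf 1_Y\simeq\mathbf 1_X$. Recollement axioms for a closed immersion $i:Z\hookrightarrow X$ with open complement $j:U=X\setminus Z\hookrightarrow X$: adjunctions $i^*\dashv i_*\dashv i^!$ and $j_!\dashv j^*\dashv j_*$; $i_*$ and $j_!$ are fully faithful; $j^*i_*=0$ and $i^*j_!=0$; and for each $M\in\mathcal C(X)$ functorial distinguished triangles $j_!j^*M\to M\to i_*i^*M\xrightarrow{+1}$ and $i_*i^!M\to M\to j_*j^*M\xrightarrow{+1}$, whose maps to and from $M$ are the adjunction counits and units. Definitions: $H^d(X;A)=\mathrm{Hom}_{\mathcal C(X)}(\mathbf 1_X,A[d])$; $H_Z^d(X;A)=\mathrm{Hom}_{\mathcal C(X)}(\mathbf 1_X,i_*i^!A[d])$; $\mathrm{forg}:H_Z^d(X;A)\to H^d(X;A)$ is induced by the counit $i_*i^!A\to A$. Applying $\mathrm{Hom}(\mathbf 1_X,-)$ to $i_*i^!A\to A\to j_*j^*A\xrightarrow{+1}$, and using $\mathrm{Hom}(\mathbf 1_X,j_*j^*A[d])\cong H^d(U;j^*A)$, gives the localisation long exact sequence $\cdots\to H_Z^d(X;A)\xrightarrow{\mathrm{forg}}H^d(X;A)\xrightarrow{j^*}H^d(U;j^*A)\xrightarrow{\delta}H_Z^{d+1}(X;A)\to\cdots$,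 which defines $j^*$ and $\delta$. *)

theory Defs
  imports "HOL-Algebra.Group_Action"
begin

section \<open>Categories, functors, adjunctions\<close>

record ('o, 'm) category =
  Obj :: "'o set"
  Arr :: "'m set"
  Dom :: "'m \<Rightarrow> 'o"
  Cod :: "'m \<Rightarrow> 'o"
  Id :: "'o \<Rightarrow> 'm"
  Comp :: "'m \<Rightarrow> 'm \<Rightarrow> 'm"  (infixr \<open>\<odot>\<index>\<close> 75)

definition Hom :: "('o, 'm, 'z) category_scheme \<Rightarrow> 'o \<Rightarrow> 'o \<Rightarrow> 'm set" where
  "Hom C x y = {f \<in> Arr C. Dom C f = x \<and> Cod C f = y}"

locale category =
  fixes C :: "('o, 'm, 'z) category_scheme" (structure)
  assumes Dom_Obj: "f \<in> Arr C \<Longrightarrow> Dom C f \<in> Obj C"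
    and Cod_Obj: "f \<in> Arr C \<Longrightarrow> Cod C f \<in> Obj C"
    and Id_Hom: "x \<in> Obj C \<Longrightarrow> Id C x \<in> Hom C x x"
    and Comp_Hom: "f \<in> Hom C x y \<Longrightarrow> g \<in> Hom C y z \<Longrightarrow> g \<odot> f \<in> Hom C x z"
    and Comp_Id: "f \<in> Hom C x y \<Longrightarrow> f \<odot> Id C x = f"
    and Id_Comp: "f \<in> Hom C x y \<Longrightarrow> Id C y \<odot> f = f"
    and Comp_assoc: "f \<in> Hom C w x \<Longrightarrow> g \<in> Hom C x y \<Longrightarrow> h \<in> Hom C y z \<Longrightarrow>
      (h \<odot> g) \<odot> f = h \<odot> (g \<odot> f)"

definition inverse_arrows :: "('o, 'm, 'z) category_scheme \<Rightarrow> 'm \<Rightarrow> 'm \<Rightarrow> bool" where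
  "inverse_arrows C f g \<longleftrightarrow> f \<in> Arr C \<and> g \<in> Hom C (Cod C f) (Dom C f) \<and>
     g \<odot>\<^bsub>C\<^esub> f = Id C (Dom C f) \<and> f \<odot>\<^bsub>C\<^esub> g = Id C (Cod C f)"

definition iso_arrow :: "('o, 'm, 'z) category_scheme \<Rightarrow> 'm \<Rightarrow> bool" where
  "iso_arrow C f \<longleftrightarrow> (\<exists>g. inverse_arrows C f g)"

definition inv_arrow :: "('o, 'm, 'z) category_scheme \<Rightarrow> 'm \<Rightarrow> 'm" where
  "inv_arrow C f = (THE g. inverse_arrows C f g)"

definition Isos :: "('o, 'm, 'z) category_scheme \<Rightarrow> 'o \<Rightarrow> 'o \<Rightarrow> 'm set" where
  "Isos C x y = {f \<in> Hom C x y. iso_arrow C f}"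

definition zero_object :: "('o, 'm, 'z) category_scheme \<Rightarrow> 'o \<Rightarrow> bool" where
  "zero_object C z \<longleftrightarrow> z \<in> Obj C \<and>
     (\<forall>x \<in> Obj C. (\<exists>!f. f \<in> Hom C x z) \<and> (\<exists>!f. f \<in> Hom C z x))"

record ('o, 'm, 'p, 'n) func =
  Ob :: "'o \<Rightarrow> 'p"
  Ar :: "'m \<Rightarrow> 'n"

locale is_functor = source: category C + target: category D
  for C :: "('o, 'm, 'y) category_scheme" and D :: "('p, 'n, 'z) category_scheme"
    and F :: "('o, 'm, 'p, 'n, 'w) func_scheme" +
  assumes Ob_Obj: "x \<in> Obj C \<Longrightarrow> Ob F x \<in> Obj D"
    and Ar_Hom: "f \<in> Hom C x y \<Longrightarrow> Ar F f \<in> Hom D (Ob F x) (Ob F y)"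
    and Ar_Id: "x \<in> Obj C \<Longrightarrow> Ar F (Id C x) = Id D (Ob F x)"
    and Ar_Comp: "f \<in> Hom C x y \<Longrightarrow> g \<in> Hom C y z \<Longrightarrow>
      Ar F (g \<odot>\<^bsub>C\<^esub> f) = Ar F g \<odot>\<^bsub>D\<^esub> Ar F f"

definition fully_faithful ::
  "('o, 'm, 'y) category_scheme \<Rightarrow> ('p, 'n, 'z) category_scheme \<Rightarrow>
   ('o, 'm, 'p, 'n, 'w) func_scheme \<Rightarrow> bool" where
  "fully_faithful C D F \<longleftrightarrow>
     (\<forall>x \<in> Obj C. \<forall>y \<in> Obj C. bij_betw (Ar F) (Hom C x y) (Hom D (Ob F x) (Ob F y)))"

text \<open>\<open>F\<close> is left adjoint to \<open>G\<close>, with unit \<open>\<eta> x : x \<rightarrow> G F x\<close> and counit \<open>\<epsilon> y : F G y \<rightarrow> y\<close>.\<close>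

locale adjunction = left: is_functor C D F + right: is_functor D C G
  for C :: "('o, 'm, 'y) category_scheme" and D :: "('p, 'n, 'z) category_scheme"
    and F :: "('o, 'm, 'p, 'n, 'v) func_scheme" and G :: "('p, 'n, 'o, 'm, 'w) func_scheme"
    and \<eta> :: "'o \<Rightarrow> 'm" and \<epsilon> :: "'p \<Rightarrow> 'n" +
  assumes unit_Hom: "x \<in> Obj C \<Longrightarrow> \<eta> x \<in> Hom C x (Ob G (Ob F x))"
    and unit_natural: "f \<in> Hom C x x' \<Longrightarrow> Ar G (Ar F f) \<odot>\<^bsub>C\<^esub> \<eta> x = \<eta> x' \<odot>\<^bsub>C\<^esub> f"
    and counit_Hom: "y \<in> Obj D \<Longrightarrow> \<epsilon> y \<in> Hom D (Ob F (Ob G y)) y"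
    and counit_natural: "g \<in> Hom D y y' \<Longrightarrow> g \<odot>\<^bsub>D\<^esub> \<epsilon> y = \<epsilon> y' \<odot>\<^bsub>D\<^esub> Ar F (Ar G g)"
    and triangle_left: "x \<in> Obj C \<Longrightarrow> \<epsilon> (Ob F x) \<odot>\<^bsub>D\<^esub> Ar F (\<eta> x) = Id D (Ob F x)"
    and triangle_right: "y \<in> Obj D \<Longrightarrow> Ar G (\<epsilon> y) \<odot>\<^bsub>C\<^esub> \<eta> (Ob G y) = Id C (Ob G y)"

section \<open>Additive and triangulated categories\<close>

record ('o, 'm) preadditive_category = "('o, 'm) category" +
  Add :: "'m \<Rightarrow> 'm \<Rightarrow> 'm"
  Zero :: "'o \<Rightarrow> 'o \<Rightarrow> 'm"

text \<open>The group \<open>Hom C x y\<close>; as always in \<^theory>\<open>HOL-Algebra.Group\<close> it is written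
  multiplicatively, so \<open>\<otimes>\<close> is addition of morphisms, \<open>\<one>\<close> the zero morphism and \<open>inv\<close> negation.\<close>

definition hom_group :: "('o, 'm, 'z) preadditive_category_scheme \<Rightarrow> 'o \<Rightarrow> 'o \<Rightarrow> 'm monoid" where
  "hom_group C x y = \<lparr>carrier = Hom C x y, mult = Add C, one = Zero C x y\<rparr>"

locale additive_category = category C
  for C :: "('o, 'm, 'z) preadditive_category_scheme" (structure) +
  assumes hom_comm_group: "x \<in> Obj C \<Longrightarrow> y \<in> Obj C \<Longrightarrow> comm_group (hom_group C x y)"
    and Comp_Add: "f \<in> Hom C x y \<Longrightarrow> g \<in> Hom C y z \<Longrightarrow> g' \<in> Hom C y z \<Longrightarrow>
      Add C g g' \<odot> f = Add C (g \<odot> f) (g' \<odot> f)"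
    and Add_Comp: "f \<in> Hom C x y \<Longrightarrow> f' \<in> Hom C x y \<Longrightarrow> g \<in> Hom C y z \<Longrightarrow>
      g \<odot> Add C f f' = Add C (g \<odot> f) (g \<odot> f')"
    and ex_zero_object: "\<exists>z. zero_object C z"
    and ex_biproduct: "x \<in> Obj C \<Longrightarrow> y \<in> Obj C \<Longrightarrow>
      \<exists>s \<in> Obj C. \<exists>i1 \<in> Hom C x s. \<exists>i2 \<in> Hom C y s. \<exists>p1 \<in> Hom C s x. \<exists>p2 \<in> Hom C s y.
        p1 \<odot> i1 = Id C x \<and> p2 \<odot> i2 = Id C y \<and> p2 \<odot> i1 = Zero C x y \<and> p1 \<odot> i2 = Zero C y x \<and>
        Add C (i1 \<odot> p1) (i2 \<odot> p2) = Id C s"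

locale additive_functor =
  is_functor C D F + source: additive_category C + target: additive_category D
  for C :: "('o, 'm, 'y) preadditive_category_scheme"
    and D :: "('p, 'n, 'z) preadditive_category_scheme"
    and F :: "('o, 'm, 'p, 'n, 'w) func_scheme" +
  assumes Ar_Add: "f \<in> Hom C x y \<Longrightarrow> g \<in> Hom C x y \<Longrightarrow>
    Ar F (Add C f g) = Add D (Ar F f) (Ar F g)"

text \<open>The translations \<open>[n]\<close>, \<open>n \<in> \<int>\<close>, form a strict action of \<open>\<int>\<close>; equivalently \<open>[1]\<close> is an
  automorphism of the category. A candidate triangle \<open>x \<rightarrow> y \<rightarrow> z \<rightarrow> x[1]\<close> is given by its three
  arrows, and \<open>DT\<close> is the class of distinguished triangles.\<close>

record ('o, 'm) triangulated_category = "('o, 'm) preadditive_category" +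
  Shift :: "int \<Rightarrow> ('o, 'm, 'o, 'm) func"
  DT :: "('m \<times> 'm \<times> 'm) set"

abbreviation shift_ob :: "('o, 'm, 'z) triangulated_category_scheme \<Rightarrow> int \<Rightarrow> 'o \<Rightarrow> 'o" where
  "shift_ob C n x \<equiv> Ob (Shift C n) x"

abbreviation shift_ar :: "('o, 'm, 'z) triangulated_category_scheme \<Rightarrow> int \<Rightarrow> 'm \<Rightarrow> 'm" where
  "shift_ar C n f \<equiv> Ar (Shift C n) f"

definition candidate_triangle ::
  "('o, 'm, 'z) triangulated_category_scheme \<Rightarrow> 'm \<Rightarrow> 'm \<Rightarrow> 'm \<Rightarrow> bool" where
  "candidate_triangle C u v w \<longleftrightarrow> u \<in> Arr C \<and> v \<in> Arr C \<and> Dom C v = Cod C u \<and>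
     w \<in> Hom C (Cod C v) (shift_ob C 1 (Dom C u))"

definition triangle_morphism ::
  "('o, 'm, 'z) triangulated_category_scheme \<Rightarrow>
   'm \<times> 'm \<times> 'm \<Rightarrow> 'm \<times> 'm \<times> 'm \<Rightarrow> 'm \<times> 'm \<times> 'm \<Rightarrow> bool" where
  "triangle_morphism C = (\<lambda>(u, v, w) (u', v', w') (a, b, c).
     a \<in> Hom C (Dom C u) (Dom C u') \<and> b \<in> Hom C (Cod C u) (Cod C u') \<and>
     c \<in> Hom C (Cod C v) (Cod C v') \<and>
     b \<odot>\<^bsub>C\<^esub> u = u' \<odot>\<^bsub>C\<^esub> a \<and> c \<odot>\<^bsub>C\<^esub> v = v' \<odot>\<^bsub>C\<^esub> b \<and> shift_ar C 1 a \<odot>\<^bsub>C\<^esub> w = w' \<odot>\<^bsub>C\<^esub> c)"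

locale triangulated = additive_category C
  for C :: "('o, 'm, 'z) triangulated_category_scheme" (structure) +
  assumes Shift_additive: "additive_functor C C (Shift C n)"
    and Shift_0_Ob: "x \<in> Obj C \<Longrightarrow> shift_ob C 0 x = x"
    and Shift_0_Ar: "f \<in> Arr C \<Longrightarrow> shift_ar C 0 f = f"
    and Shift_add_Ob: "x \<in> Obj C \<Longrightarrow> shift_ob C k (shift_ob C n x) = shift_ob C (k + n) x"
    and Shift_add_Ar: "f \<in> Arr C \<Longrightarrow> shift_ar C k (shift_ar C n f) = shift_ar C (k + n) f"
    and DT_candidate: "(u, v, w) \<in> DT C \<Longrightarrow> candidate_triangle C u v w"
    and DT_Id: "x \<in> Obj C \<Longrightarrow> zero_object C z \<Longrightarrow>
      (Id C x, Zero C x z, Zero C z (shift_ob C 1 x)) \<in> DT C"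
    and DT_iso: "(u, v, w) \<in> DT C \<Longrightarrow> candidate_triangle C u' v' w' \<Longrightarrow>
      triangle_morphism C (u, v, w) (u', v', w') (a, b, c) \<Longrightarrow>
      iso_arrow C a \<Longrightarrow> iso_arrow C b \<Longrightarrow> iso_arrow C c \<Longrightarrow> (u', v', w') \<in> DT C"
    and DT_cone: "u \<in> Arr C \<Longrightarrow> \<exists>v w. (u, v, w) \<in> DT C"
    and DT_rotate: "u \<in> Hom C x y \<Longrightarrow> candidate_triangle C u v w \<Longrightarrow>
      (u, v, w) \<in> DT C \<longleftrightarrow>
      (v, w, inv\<^bsub>hom_group C (shift_ob C 1 x) (shift_ob C 1 y)\<^esub> (shift_ar C 1 u)) \<in> DT C"
    and DT_complete: "(u, v, w) \<in> DT C \<Longrightarrow> (u', v', w') \<in> DT C \<Longrightarrow>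
      a \<in> Hom C (Dom C u) (Dom C u') \<Longrightarrow> b \<in> Hom C (Cod C u) (Cod C u') \<Longrightarrow>
      b \<odot> u = u' \<odot> a \<Longrightarrow> \<exists>c. triangle_morphism C (u, v, w) (u', v', w') (a, b, c)"
    and octahedral: "f \<in> Hom C x y \<Longrightarrow> g \<in> Hom C y z \<Longrightarrow>
      (f, p1, d1) \<in> DT C \<Longrightarrow> (g \<odot> f, p2, d2) \<in> DT C \<Longrightarrow> (g, p3, d3) \<in> DT C \<Longrightarrow>
      \<exists>a b. (a, b, shift_ar C 1 p1 \<odot> d3) \<in> DT C \<and>
        triangle_morphism C (f, p1, d1) (g \<odot> f, p2, d2) (Id C x, g, a) \<and>
        triangle_morphism C (g \<odot> f, p2, d2) (g, p3, d3) (f, Id C z, b)"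

text \<open>An exact functor carries natural isomorphisms \<open>ShIso F x : F (x[1]) \<rightarrow> (F x)[1]\<close>.\<close>

record ('o, 'm, 'p, 'n) exact_func = "('o, 'm, 'p, 'n) func" +
  ShIso :: "'o \<Rightarrow> 'n"

locale exact_functor =
  additive_functor C D F + source: triangulated C + target: triangulated D
  for C :: "('o, 'm, 'y) triangulated_category_scheme"
    and D :: "('p, 'n, 'z) triangulated_category_scheme"
    and F :: "('o, 'm, 'p, 'n, 'w) exact_func_scheme" +
  assumes ShIso_iso: "x \<in> Obj C \<Longrightarrow>
      ShIso F x \<in> Isos D (Ob F (shift_ob C 1 x)) (shift_ob D 1 (Ob F x))"
    and ShIso_natural: "f \<in> Hom C x y \<Longrightarrow>
      shift_ar D 1 (Ar F f) \<odot>\<^bsub>D\<^esub> ShIso F x = ShIso F y \<odot>\<^bsub>D\<^esub> Ar F (shift_ar C 1 f)"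
    and Ar_DT: "(u, v, w) \<in> DT C \<Longrightarrow>
      (Ar F u, Ar F v, ShIso F (Dom C u) \<odot>\<^bsub>D\<^esub> Ar F w) \<in> DT D"

text \<open>The iterates \<open>F (x[n]) \<rightarrow> (F x)[n]\<close> of \<open>ShIso F\<close>. For \<open>n = -k < 0\<close> one shifts
  \<open>F x = F (x[-k][k]) \<rightarrow> (F (x[-k]))[k]\<close> by \<open>-k\<close> and inverts.\<close>

primrec shift_iso_nat ::
  "('o, 'm, 'y) triangulated_category_scheme \<Rightarrow> ('p, 'n, 'z) triangulated_category_scheme \<Rightarrow>
   ('o, 'm, 'p, 'n, 'w) exact_func_scheme \<Rightarrow> nat \<Rightarrow> 'o \<Rightarrow> 'n" where
  "shift_iso_nat C D F 0 x = Id D (Ob F x)"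
| "shift_iso_nat C D F (Suc k) x =
     shift_ar D 1 (shift_iso_nat C D F k x) \<odot>\<^bsub>D\<^esub> ShIso F (shift_ob C (int k) x)"

definition shift_iso ::
  "('o, 'm, 'y) triangulated_category_scheme \<Rightarrow> ('p, 'n, 'z) triangulated_category_scheme \<Rightarrow>
   ('o, 'm, 'p, 'n, 'w) exact_func_scheme \<Rightarrow> int \<Rightarrow> 'o \<Rightarrow> 'n" where
  "shift_iso C D F n x =
     (if 0 \<le> n then shift_iso_nat C D F (nat n) x
      else inv_arrow D (shift_ar D n (shift_iso_nat C D F (nat (- n)) (shift_ob C n x))))"

section \<open>Symmetric monoidal structures\<close>

record ('o, 'm) tt_category = "('o, 'm) triangulated_category" +
  TensOb :: "'o \<Rightarrow> 'o \<Rightarrow> 'o"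
  TensAr :: "'m \<Rightarrow> 'm \<Rightarrow> 'm"
  Unit :: "'o"
  Assoc :: "'o \<Rightarrow> 'o \<Rightarrow> 'o \<Rightarrow> 'm"
  LUnit :: "'o \<Rightarrow> 'm"
  RUnit :: "'o \<Rightarrow> 'm"
  Swap :: "'o \<Rightarrow> 'o \<Rightarrow> 'm"

locale symmetric_monoidal = category C
  for C :: "('o, 'm, 'z) tt_category_scheme" (structure) +
  assumes TensOb_Obj: "x \<in> Obj C \<Longrightarrow> y \<in> Obj C \<Longrightarrow> TensOb C x y \<in> Obj C"
    and TensAr_Hom: "f \<in> Hom C x x' \<Longrightarrow> g \<in> Hom C y y' \<Longrightarrow>
      TensAr C f g \<in> Hom C (TensOb C x y) (TensOb C x' y')"
    and TensAr_Id: "x \<in> Obj C \<Longrightarrow> y \<in> Obj C \<Longrightarrow>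
      TensAr C (Id C x) (Id C y) = Id C (TensOb C x y)"
    and TensAr_Comp: "f \<in> Hom C x x' \<Longrightarrow> f' \<in> Hom C x' x'' \<Longrightarrow>
      g \<in> Hom C y y' \<Longrightarrow> g' \<in> Hom C y' y'' \<Longrightarrow>
      TensAr C (f' \<odot> f) (g' \<odot> g) = TensAr C f' g' \<odot> TensAr C f g"
    and Unit_Obj: "Unit C \<in> Obj C"
    and Assoc_iso: "x \<in> Obj C \<Longrightarrow> y \<in> Obj C \<Longrightarrow> z \<in> Obj C \<Longrightarrow>
      Assoc C x y z \<in> Isos C (TensOb C (TensOb C x y) z) (TensOb C x (TensOb C y z))"
    and Assoc_natural: "f \<in> Hom C x x' \<Longrightarrow> g \<in> Hom C y y' \<Longrightarrow> h \<in> Hom C z z' \<Longrightarrow>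
      TensAr C f (TensAr C g h) \<odot> Assoc C x y z = Assoc C x' y' z' \<odot> TensAr C (TensAr C f g) h"
    and LUnit_iso: "x \<in> Obj C \<Longrightarrow> LUnit C x \<in> Isos C (TensOb C (Unit C) x) x"
    and LUnit_natural: "f \<in> Hom C x y \<Longrightarrow>
      f \<odot> LUnit C x = LUnit C y \<odot> TensAr C (Id C (Unit C)) f"
    and RUnit_iso: "x \<in> Obj C \<Longrightarrow> RUnit C x \<in> Isos C (TensOb C x (Unit C)) x"
    and RUnit_natural: "f \<in> Hom C x y \<Longrightarrow>
      f \<odot> RUnit C x = RUnit C y \<odot> TensAr C f (Id C (Unit C))"
    and Swap_iso: "x \<in> Obj C \<Longrightarrow> y \<in> Obj C \<Longrightarrow>
      Swap C x y \<in> Isos C (TensOb C x y) (TensOb C y x)"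
    and Swap_natural: "f \<in> Hom C x x' \<Longrightarrow> g \<in> Hom C y y' \<Longrightarrow>
      TensAr C g f \<odot> Swap C x y = Swap C x' y' \<odot> TensAr C f g"
    and pentagon: "w \<in> Obj C \<Longrightarrow> x \<in> Obj C \<Longrightarrow> y \<in> Obj C \<Longrightarrow> z \<in> Obj C \<Longrightarrow>
      Assoc C w x (TensOb C y z) \<odot> Assoc C (TensOb C w x) y z =
      TensAr C (Id C w) (Assoc C x y z) \<odot> Assoc C w (TensOb C x y) z \<odot>
        TensAr C (Assoc C w x y) (Id C z)"
    and unit_triangle: "x \<in> Obj C \<Longrightarrow> y \<in> Obj C \<Longrightarrow>
      TensAr C (Id C x) (LUnit C y) \<odot> Assoc C x (Unit C) y = TensAr C (RUnit C x) (Id C y)"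
    and hexagon: "x \<in> Obj C \<Longrightarrow> y \<in> Obj C \<Longrightarrow> z \<in> Obj C \<Longrightarrow>
      Assoc C y z x \<odot> Swap C x (TensOb C y z) \<odot> Assoc C x y z =
      TensAr C (Id C y) (Swap C x z) \<odot> Assoc C y x z \<odot> TensAr C (Swap C x y) (Id C z)"
    and Swap_Swap: "x \<in> Obj C \<Longrightarrow> y \<in> Obj C \<Longrightarrow>
      Swap C y x \<odot> Swap C x y = Id C (TensOb C x y)"

record ('o, 'm, 'p, 'n) tt_func = "('o, 'm, 'p, 'n) exact_func" +
  MonUnit :: "'n"
  MonTens :: "'o \<Rightarrow> 'o \<Rightarrow> 'n"

text \<open>Strong symmetric monoidal functors: \<open>MonUnit F : 1 \<rightarrow> F 1\<close> and
  \<open>MonTens F x y : F x \<otimes> F y \<rightarrow> F (x \<otimes> y)\<close> are isomorphisms.\<close>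

locale symmetric_monoidal_functor =
  is_functor C D F + source: symmetric_monoidal C + target: symmetric_monoidal D
  for C :: "('o, 'm, 'y) tt_category_scheme"
    and D :: "('p, 'n, 'z) tt_category_scheme"
    and F :: "('o, 'm, 'p, 'n, 'w) tt_func_scheme" +
  assumes MonUnit_iso: "MonUnit F \<in> Isos D (Unit D) (Ob F (Unit C))"
    and MonTens_iso: "x \<in> Obj C \<Longrightarrow> y \<in> Obj C \<Longrightarrow>
      MonTens F x y \<in> Isos D (TensOb D (Ob F x) (Ob F y)) (Ob F (TensOb C x y))"
    and MonTens_natural: "f \<in> Hom C x x' \<Longrightarrow> g \<in> Hom C y y' \<Longrightarrow>
      Ar F (TensAr C f g) \<odot>\<^bsub>D\<^esub> MonTens F x y =
      MonTens F x' y' \<odot>\<^bsub>D\<^esub> TensAr D (Ar F f) (Ar F g)"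
    and MonTens_Assoc: "x \<in> Obj C \<Longrightarrow> y \<in> Obj C \<Longrightarrow> z \<in> Obj C \<Longrightarrow>
      Ar F (Assoc C x y z) \<odot>\<^bsub>D\<^esub> MonTens F (TensOb C x y) z \<odot>\<^bsub>D\<^esub>
        TensAr D (MonTens F x y) (Id D (Ob F z)) =
      MonTens F x (TensOb C y z) \<odot>\<^bsub>D\<^esub> TensAr D (Id D (Ob F x)) (MonTens F y z) \<odot>\<^bsub>D\<^esub>
        Assoc D (Ob F x) (Ob F y) (Ob F z)"
    and MonTens_LUnit: "x \<in> Obj C \<Longrightarrow>
      Ar F (LUnit C x) \<odot>\<^bsub>D\<^esub> MonTens F (Unit C) x \<odot>\<^bsub>D\<^esub> TensAr D (MonUnit F) (Id D (Ob F x)) =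
      LUnit D (Ob F x)"
    and MonTens_RUnit: "x \<in> Obj C \<Longrightarrow>
      Ar F (RUnit C x) \<odot>\<^bsub>D\<^esub> MonTens F x (Unit C) \<odot>\<^bsub>D\<^esub> TensAr D (Id D (Ob F x)) (MonUnit F) =
      RUnit D (Ob F x)"
    and MonTens_Swap: "x \<in> Obj C \<Longrightarrow> y \<in> Obj C \<Longrightarrow>
      Ar F (Swap C x y) \<odot>\<^bsub>D\<^esub> MonTens F x y = MonTens F y x \<odot>\<^bsub>D\<^esub> Swap D (Ob F x) (Ob F y)"

section \<open>Coefficient systems and recollement\<close>

text \<open>\<open>OpenCompl\<close> relates a closed immersion to its open complement.\<close>

record ('s, 'f) spaces = "('s, 'f) category" +
  ClosedImm :: "'f set"
  OpenCompl :: "('f \<times> 'f) set"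

locale space_category = category S
  for S :: "('s, 'f, 'z) spaces_scheme" +
  assumes ClosedImm_Arr: "ClosedImm S \<subseteq> Arr S"
    and OpenCompl_Arr: "(i, j) \<in> OpenCompl S \<Longrightarrow>
      i \<in> ClosedImm S \<and> j \<in> Arr S \<and> Cod S j = Cod S i"

text \<open>\<open>Coef K X\<close> is the category attached to the space \<open>X\<close>; for \<open>f : X \<rightarrow> Y\<close>, \<open>Pull K f\<close> and
  \<open>Push K f\<close> are the functors between \<open>Coef K Y\<close> and \<open>Coef K X\<close> usually written with an upper
  resp. lower star, and \<open>AdjUnit K f\<close>, \<open>AdjCounit K f\<close> exhibit their adjunction. A single type of
  objects and a single type of arrows serve all spaces, which loses no generality since the
  carriers vary with the space.\<close>

record ('s, 'f, 'o, 'm) coefficients =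
  Spaces :: "('s, 'f) spaces"
  Coef :: "'s \<Rightarrow> ('o, 'm) tt_category"
  Pull :: "'f \<Rightarrow> ('o, 'm, 'o, 'm) tt_func"
  Push :: "'f \<Rightarrow> ('o, 'm, 'o, 'm) exact_func"
  AdjUnit :: "'f \<Rightarrow> 'o \<Rightarrow> 'm"
  AdjCounit :: "'f \<Rightarrow> 'o \<Rightarrow> 'm"

abbreviation CDom :: "('s, 'f, 'o, 'm) coefficients \<Rightarrow> 'f \<Rightarrow> ('o, 'm) tt_category" where
  "CDom K f \<equiv> Coef K (Dom (Spaces K) f)"

abbreviation CCod :: "('s, 'f, 'o, 'm) coefficients \<Rightarrow> 'f \<Rightarrow> ('o, 'm) tt_category" where
  "CCod K f \<equiv> Coef K (Cod (Spaces K) f)"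

locale coefficient_system =
  fixes K :: "('s, 'f, 'o, 'm) coefficients"
  assumes Spaces: "space_category (Spaces K)"
    and Coef_triangulated: "X \<in> Obj (Spaces K) \<Longrightarrow> triangulated (Coef K X)"
    and Coef_monoidal: "X \<in> Obj (Spaces K) \<Longrightarrow> symmetric_monoidal (Coef K X)"
    and Pull_exact: "f \<in> Arr (Spaces K) \<Longrightarrow> exact_functor (CCod K f) (CDom K f) (Pull K f)"
    and Pull_monoidal: "f \<in> Arr (Spaces K) \<Longrightarrow>
      symmetric_monoidal_functor (CCod K f) (CDom K f) (Pull K f)"
    and Push_exact: "f \<in> Arr (Spaces K) \<Longrightarrow> exact_functor (CDom K f) (CCod K f) (Push K f)"
    and Pull_Push: "f \<in> Arr (Spaces K) \<Longrightarrow>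
      adjunction (CCod K f) (CDom K f) (Pull K f) (Push K f) (AdjUnit K f) (AdjCounit K f)"

text \<open>\<open>UpShriek\<close> is the right adjoint of \<open>Push K i\<close> and \<open>LowShriek\<close> the left adjoint of
  \<open>Pull K j\<close>; being adjoint to exact functors, both are automatically exact. \<open>Bd M\<close> and \<open>Bd' M\<close> are the third arrows of the localisation triangles
  starting at \<open>LowShriek (Pull K j M)\<close> and at \<open>Push K i (UpShriek M)\<close> respectively.\<close>

record ('o, 'm) recollement_data =
  UpShriek :: "('o, 'm, 'o, 'm) func"
  UpUnit :: "'o \<Rightarrow> 'm"
  UpCounit :: "'o \<Rightarrow> 'm"
  LowShriek :: "('o, 'm, 'o, 'm) func"
  LowUnit :: "'o \<Rightarrow> 'm"
  LowCounit :: "'o \<Rightarrow> 'm"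
  Bd :: "'o \<Rightarrow> 'm"
  Bd' :: "'o \<Rightarrow> 'm"

locale recollement =
  fixes K :: "('s, 'f, 'o, 'm) coefficients" and i j :: 'f and R :: "('o, 'm) recollement_data"
  assumes Pull_Push_i: "adjunction (CCod K i) (CDom K i) (Pull K i) (Push K i)
      (AdjUnit K i) (AdjCounit K i)"
    and Push_UpShriek: "adjunction (CDom K i) (CCod K i) (Push K i) (UpShriek R)
      (UpUnit R) (UpCounit R)"
    and LowShriek_Pull: "adjunction (CDom K j) (CCod K j) (LowShriek R) (Pull K j)
      (LowUnit R) (LowCounit R)"
    and Pull_Push_j: "adjunction (CCod K j) (CDom K j) (Pull K j) (Push K j)
      (AdjUnit K j) (AdjCounit K j)"
    and Push_ff: "fully_faithful (CDom K i) (CCod K i) (Push K i)"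
    and LowShriek_ff: "fully_faithful (CDom K j) (CCod K j) (LowShriek R)"
    and Pull_Push_zero: "M \<in> Obj (CDom K i) \<Longrightarrow>
      zero_object (CDom K j) (Ob (Pull K j) (Ob (Push K i) M))"
    and Pull_LowShriek_zero: "M \<in> Obj (CDom K j) \<Longrightarrow>
      zero_object (CDom K i) (Ob (Pull K i) (Ob (LowShriek R) M))"
    and triangle: "M \<in> Obj (CCod K i) \<Longrightarrow>
      (LowCounit R M, AdjUnit K i M, Bd R M) \<in> DT (CCod K i)"
    and triangle_natural: "f \<in> Hom (CCod K i) M N \<Longrightarrow>
      shift_ar (CCod K i) 1 (Ar (LowShriek R) (Ar (Pull K j) f)) \<odot>\<^bsub>CCod K i\<^esub> Bd R M =
      Bd R N \<odot>\<^bsub>CCod K i\<^esub> Ar (Push K i) (Ar (Pull K i) f)"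
    and triangle': "M \<in> Obj (CCod K i) \<Longrightarrow>
      (UpCounit R M, AdjUnit K j M, Bd' R M) \<in> DT (CCod K i)"
    and triangle'_natural: "f \<in> Hom (CCod K i) M N \<Longrightarrow>
      shift_ar (CCod K i) 1 (Ar (Push K i) (Ar (UpShriek R) f)) \<odot>\<^bsub>CCod K i\<^esub> Bd' R M =
      Bd' R N \<odot>\<^bsub>CCod K i\<^esub> Ar (Push K j) (Ar (Pull K j) f)"

section \<open>Cohomology, cohomology with support, and the localisation sequence\<close>

definition cohomology :: "('s, 'f, 'o, 'm) coefficients \<Rightarrow> 's \<Rightarrow> int \<Rightarrow> 'o \<Rightarrow> 'm monoid" where
  "cohomology K X d A = hom_group (Coef K X) (Unit (Coef K X)) (shift_ob (Coef K X) d A)"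

definition support_cohomology ::
  "('s, 'f, 'o, 'm) coefficients \<Rightarrow> ('o, 'm) recollement_data \<Rightarrow> 'f \<Rightarrow> int \<Rightarrow> 'o \<Rightarrow> 'm monoid" where
  "support_cohomology K R i d A =
     cohomology K (Cod (Spaces K) i) d (Ob (Push K i) (Ob (UpShriek R) A))"

definition forg ::
  "('s, 'f, 'o, 'm) coefficients \<Rightarrow> ('o, 'm) recollement_data \<Rightarrow> 'f \<Rightarrow> int \<Rightarrow> 'o \<Rightarrow> 'm \<Rightarrow> 'm" where
  "forg K R i d A a = shift_ar (CCod K i) d (UpCounit R A) \<odot>\<^bsub>CCod K i\<^esub> a"

text \<open>For \<open>j : U \<rightarrow> X\<close> and \<open>B\<close> in \<open>Coef K U\<close>, the isomorphism
  \<open>Hom(1, (j\<^sub>* B)[d]) \<cong> Hom(1, j\<^sub>* (B[d])) \<cong> Hom(j\<^sup>* 1, B[d]) \<cong> Hom(1, B[d])\<close>.\<close>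

definition push_iso :: "('s, 'f, 'o, 'm) coefficients \<Rightarrow> 'f \<Rightarrow> int \<Rightarrow> 'o \<Rightarrow> 'm \<Rightarrow> 'm" where
  "push_iso K j d B x =
     AdjCounit K j (shift_ob (CDom K j) d B) \<odot>\<^bsub>CDom K j\<^esub>
     Ar (Pull K j)
       (inv_arrow (CCod K j) (shift_iso (CDom K j) (CCod K j) (Push K j) d B) \<odot>\<^bsub>CCod K j\<^esub> x)
       \<odot>\<^bsub>CDom K j\<^esub>
     MonUnit (Pull K j)"

definition restriction :: "('s, 'f, 'o, 'm) coefficients \<Rightarrow> 'f \<Rightarrow> int \<Rightarrow> 'o \<Rightarrow> 'm \<Rightarrow> 'm" where
  "restriction K j d A a =
     push_iso K j d (Ob (Pull K j) A)
       (shift_ar (CCod K j) d (AdjUnit K j A) \<odot>\<^bsub>CCod K j\<^esub> a)"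

text \<open>The connecting map from degree \<open>d\<close> cohomology of \<open>U\<close> to degree \<open>d + 1\<close> cohomology of \<open>X\<close>
  with support, induced by \<open>(Bd' R A)[d]\<close> (no sign is introduced).\<close>

definition connecting ::
  "('s, 'f, 'o, 'm) coefficients \<Rightarrow> ('o, 'm) recollement_data \<Rightarrow> 'f \<Rightarrow> int \<Rightarrow> 'o \<Rightarrow> 'm \<Rightarrow> 'm" where
  "connecting K R j d A b =
     shift_ar (CCod K j) d (Bd' R A) \<odot>\<^bsub>CCod K j\<^esub>
     the_inv_into
       (carrier (cohomology K (Cod (Spaces K) j) d (Ob (Push K j) (Ob (Pull K j) A))))
       (push_iso K j d (Ob (Pull K j) A)) b"

definition connecting_image ::
  "('s, 'f, 'o, 'm) coefficients \<Rightarrow> ('o, 'm) recollement_data \<Rightarrow> 'f \<Rightarrow> int \<Rightarrow> 'o \<Rightarrow> 'm set" where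
  "connecting_image K R j d A =
     connecting K R j d A ` carrier (cohomology K (Dom (Spaces K) j) d (Ob (Pull K j) A))"

definition refinements ::
  "('s, 'f, 'o, 'm) coefficients \<Rightarrow> ('o, 'm) recollement_data \<Rightarrow> 'f \<Rightarrow> int \<Rightarrow> 'o \<Rightarrow> 'm \<Rightarrow> 'm set" where
  "refinements K R i d A \<alpha> =
     {a \<in> carrier (support_cohomology K R i d A). forg K R i d A a = \<alpha>}"

section \<open>Principal homogeneous spaces\<close>

definition principal_homogeneous_space ::
  "('g, 'z) monoid_scheme \<Rightarrow> 'e set \<Rightarrow> ('g \<Rightarrow> 'e \<Rightarrow> 'e) \<Rightarrow> bool" where
  "principal_homogeneous_space G E \<phi> \<longleftrightarrow> group_action G E \<phi> \<and> E \<noteq> {} \<and>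
     (\<forall>x \<in> E. \<forall>y \<in> E. \<exists>!g. g \<in> carrier G \<and> \<phi> g x = y)"

text \<open>\<^const>\<open>group_action\<close> asks each \<open>\<phi> g\<close> to be an extensional function on \<open>E\<close>.\<close>

definition translation :: "('g, 'z) monoid_scheme \<Rightarrow> 'g set \<Rightarrow> 'g \<Rightarrow> 'g \<Rightarrow> 'g" where
  "translation G E g = (\<lambda>x \<in> E. g \<otimes>\<^bsub>G\<^esub> x)"

end

theory Submission
  imports Defs
begin

text \<open>A nonempty fibre of a group homomorphism is a torsor under its kernel, so everything rests on
  exactness of \<open>Hom(1, -)\<close> on the localisation triangle. Applying \<open>[-d]\<close> turns a morphism
  \<open>1 \<rightarrow> A[d]\<close> into \<open>1[-d] \<rightarrow> A\<close>, which reduces exactness in degree \<open>d\<close> to the unshifted case with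
  an arbitrary source \<open>T\<close>; there the factorisation comes from completing a morphism from the
  rotation of \<open>T \<rightarrow> T \<rightarrow> 0 \<rightarrow> T[1]\<close>. The isomorphism \<open>Hom(1, (j\<^sub>* B)[d]) \<cong> Hom(1, B[d])\<close> then
  identifies the third term with the cohomology of \<open>U\<close>.\<close>

section \<open>Torsors\<close>

text \<open>Two points \<open>x\<close> and \<open>y\<close> of the fibre differ by
  \<open>y \<otimes> inv x\<close>, which \<open>h\<close> sends to the neutral element; conversely,
  translation by an element of the kernel leaves the value of \<open>h\<close> unchanged.\<close>

lemma principal_homogeneous_space_fibre:
  assumes "group_hom G H h" and ne: "{x \<in> carrier G. h x = a} \<noteq> {}"
  shows "principal_homogeneous_space (G\<lparr>carrier := kernel G H h\<rparr>) {x \<in> carrier G. h x = a}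
    (translation G {x \<in> carrier G. h x = a})"
    (is "principal_homogeneous_space ?N ?E ?t")
proof -
  interpret group_hom G H h by fact
  let ?k = "kernel G H h"
  have sub: "subgroup ?k G" by (rule subgroup_kernel)
  interpret N: group ?N by (rule subgroup.subgroup_is_group[OF sub G.group_axioms])
  have kD: "g \<in> carrier G" "h g = \<one>\<^bsub>H\<^esub>" if "g \<in> ?k" for g
    using that by (auto simp: kernel_def)
  have closed: "g \<otimes>\<^bsub>G\<^esub> x \<in> ?E" if "g \<in> ?k" "x \<in> ?E" for g x
    using that kD[OF that(1)] by auto
  have inv_k: "inv\<^bsub>G\<^esub> g \<in> ?k" if "g \<in> ?k" for g
    using sub that by (rule subgroup.m_inv_closed)
  have bij: "bij_betw (?t g) ?E ?E" if g: "g \<in> ?k" for g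
  proof (rule bij_betw_byWitness[where f' = "?t (inv\<^bsub>G\<^esub> g)"])
    show "\<forall>x\<in>?E. ?t (inv\<^bsub>G\<^esub> g) (?t g x) = x"
    proof
      fix x assume x: "x \<in> ?E"
      show "?t (inv\<^bsub>G\<^esub> g) (?t g x) = x"
        using closed[OF g x] x kD[OF g] by (simp add: translation_def G.m_assoc[symmetric])
    qed
    show "\<forall>x\<in>?E. ?t g (?t (inv\<^bsub>G\<^esub> g) x) = x"
    proof
      fix x assume x: "x \<in> ?E"
      show "?t g (?t (inv\<^bsub>G\<^esub> g) x) = x"
        using closed[OF inv_k[OF g] x] x kD[OF g]
        by (simp add: translation_def G.m_assoc[symmetric])
    qed
    show "?t g ` ?E \<subseteq> ?E" using closed[OF g] by (auto simp: translation_def)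
    show "?t (inv\<^bsub>G\<^esub> g) ` ?E \<subseteq> ?E"
      using closed[OF inv_k[OF g]] by (auto simp: translation_def)
  qed
  have "?t \<in> hom ?N (BijGroup ?E)"
  proof (rule homI)
    fix g assume "g \<in> carrier ?N"
    then show "?t g \<in> carrier (BijGroup ?E)"
      using bij by (auto simp: BijGroup_def Bij_def translation_def)
  next
    fix g k assume "g \<in> carrier ?N" "k \<in> carrier ?N"
    then have gk: "g \<in> ?k" "k \<in> ?k" by auto
    \<comment> \<open>The product of \<open>BijGroup ?E\<close> is restricted to
      \<open>Bij ?E\<close>, so it unfolds to composition only once both factors are known to lie
      there.\<close>
    have B: "?t g \<in> Bij ?E" "?t k \<in> Bij ?E"
      using bij[OF gk(1)] bij[OF gk(2)] by (auto simp: Bij_def translation_def)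
    show "?t (g \<otimes>\<^bsub>?N\<^esub> k) = ?t g \<otimes>\<^bsub>BijGroup ?E\<^esub> ?t k"
    proof
      fix x
      show "?t (g \<otimes>\<^bsub>?N\<^esub> k) x = (?t g \<otimes>\<^bsub>BijGroup ?E\<^esub> ?t k) x"
      proof (cases "x \<in> ?E")
        case True
        then show ?thesis
          using closed[OF gk(2) True] B kD[OF gk(1)] kD[OF gk(2)]
          by (simp add: BijGroup_def compose_def translation_def G.m_assoc)
      next
        \<comment> \<open>Off \<open>?E\<close> both sides are \<open>undefined\<close>, because
          \<open>translation\<close> and \<open>compose\<close> are extensional.\<close>
        case False
        then show ?thesis
          using B by (auto simp: BijGroup_def compose_def translation_def)
      qed
    qed
  qed
  then have "group_action ?N ?E ?t"
    by (simp add: group_action_def group_hom_def group_hom_axioms_def group_BijGroup N.group_axioms)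
  moreover have "\<exists>!g. g \<in> carrier ?N \<and> ?t g x = y" if x: "x \<in> ?E" and y: "y \<in> ?E" for x y
  proof (rule ex1I[of _ "y \<otimes>\<^bsub>G\<^esub> inv\<^bsub>G\<^esub> x"])
    show "y \<otimes>\<^bsub>G\<^esub> inv\<^bsub>G\<^esub> x \<in> carrier ?N \<and> ?t (y \<otimes>\<^bsub>G\<^esub> inv\<^bsub>G\<^esub> x) x = y"
      using x y by (auto simp: translation_def kernel_def G.m_assoc)
  next
    fix g assume "g \<in> carrier ?N \<and> ?t g x = y"
    then have "g \<in> ?k" "g \<otimes>\<^bsub>G\<^esub> x = y" using x by (auto simp: translation_def)
    then show "g = y \<otimes>\<^bsub>G\<^esub> inv\<^bsub>G\<^esub> x" using x kD[of g] by (auto simp: G.m_assoc)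
  qed
  ultimately show ?thesis using ne by (simp add: principal_homogeneous_space_def)
qed

text \<open>After the choice of a base point \<open>e\<close>, the map sending \<open>g\<close> to
  \<open>\<phi> g e\<close> is a bijection from the group to \<open>E\<close>, so one is a singleton
  exactly when the other is.\<close>

lemma principal_homogeneous_space_ex1_iff:
  assumes "principal_homogeneous_space G E \<phi>"
  shows "(\<exists>!a. a \<in> E) \<longleftrightarrow> carrier G = {\<one>\<^bsub>G\<^esub>}"
proof -
  interpret group_action G E \<phi>
    using assms by (simp add: principal_homogeneous_space_def)
  interpret G: group G using group_hom by (rule group_hom.axioms(1))
  have ex1: "\<exists>!g. g \<in> carrier G \<and> \<phi> g x = y" if "x \<in> E" "y \<in> E" for x y
    using assms that by (simp add: principal_homogeneous_space_def)
  obtain e where e: "e \<in> E"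
    using assms by (auto simp: principal_homogeneous_space_def)
  show ?thesis
  proof
    assume "\<exists>!a. a \<in> E"
    then have "\<phi> g e = e" if "g \<in> carrier G" for g
      using element_image[OF that e refl] e by blast
    then have "g = \<one>\<^bsub>G\<^esub>" if "g \<in> carrier G" for g
      using ex1[OF e e] that G.one_closed by blast
    then show "carrier G = {\<one>\<^bsub>G\<^esub>}" using G.one_closed by blast
  next
    assume "carrier G = {\<one>\<^bsub>G\<^esub>}"
    then have "x = e" if "x \<in> E" for x
      using ex1[OF e that] id_eq_one e by (metis restrict_apply' singletonD)
    with e show "\<exists>!a. a \<in> E" by blast
  qed
qed

section \<open>Isomorphisms and shifts\<close>

context category
begin

lemma Hom_Obj: "f \<in> Hom C x y \<Longrightarrow> x \<in> Obj C" "f \<in> Hom C x y \<Longrightarrow> y \<in> Obj C"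
  using Dom_Obj Cod_Obj by (auto simp: Hom_def)

lemma Isos_iff:
  "f \<in> Isos C x y \<longleftrightarrow> f \<in> Hom C x y \<and> (\<exists>g \<in> Hom C y x. g \<odot> f = Id C x \<and> f \<odot> g = Id C y)"
  by (auto simp: Isos_def iso_arrow_def inverse_arrows_def Hom_def)

text \<open>Both sides equal \<open>g \<odot> f \<odot> g'\<close>. This makes the definite
  description in \<open>inv_arrow\<close> meaningful.\<close>

lemma inverse_unique:
  assumes "f \<in> Hom C x y" "g \<in> Hom C y x" "g' \<in> Hom C y x" "g \<odot> f = Id C x" "f \<odot> g' = Id C y"
  shows "g = g'"
  using Comp_assoc[OF assms(3,1,2)] assms Comp_Id[OF assms(2)] Id_Comp[OF assms(3)] by simp

lemma inv_arrow:
  assumes "f \<in> Isos C x y"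
  shows "inv_arrow C f \<in> Hom C y x" "inv_arrow C f \<odot> f = Id C x" "f \<odot> inv_arrow C f = Id C y"
proof -
  have f: "f \<in> Hom C x y" using assms by (simp add: Isos_def)
  obtain g where g: "inverse_arrows C f g" using assms by (auto simp: Isos_def iso_arrow_def)
  have "inverse_arrows C f (inv_arrow C f)"
    unfolding inv_arrow_def
  proof (rule theI[of _ g])
    show "inverse_arrows C f g" by fact
    show "g' = g" if "inverse_arrows C f g'" for g'
      using inverse_unique[OF f, of g' g] f g that by (auto simp: inverse_arrows_def Hom_def)
  qed
  with f show "inv_arrow C f \<in> Hom C y x" "inv_arrow C f \<odot> f = Id C x"
    "f \<odot> inv_arrow C f = Id C y"
    by (auto simp: inverse_arrows_def Hom_def)
qed

lemma inv_arrow_Isos: "f \<in> Isos C x y \<Longrightarrow> inv_arrow C f \<in> Isos C y x"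
  using inv_arrow[of f x y] by (auto simp: Isos_iff)

lemma Comp_Isos:
  assumes "f \<in> Isos C x y" "g \<in> Isos C y z"
  shows "g \<odot> f \<in> Isos C x z"
proof -
  obtain f' where f': "f' \<in> Hom C y x" "f' \<odot> f = Id C x" "f \<odot> f' = Id C y"
    and f: "f \<in> Hom C x y" using assms(1) by (auto simp: Isos_iff)
  obtain g' where g': "g' \<in> Hom C z y" "g' \<odot> g = Id C y" "g \<odot> g' = Id C z"
    and g: "g \<in> Hom C y z" using assms(2) by (auto simp: Isos_iff)
  have "(f' \<odot> g') \<odot> (g \<odot> f) = Id C x"
    using Comp_assoc[OF Comp_Hom[OF f g] g'(1) f'(1)] Comp_assoc[OF f g g'(1)] g' f' Id_Comp[OF f]
    by simp
  moreover have "(g \<odot> f) \<odot> (f' \<odot> g') = Id C z"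
    using Comp_assoc[OF Comp_Hom[OF g'(1) f'(1)] f g] Comp_assoc[OF g'(1) f'(1) f] g' f'
      Id_Comp[OF g'(1)]
    by simp
  ultimately show ?thesis
    using Comp_Hom[OF f g] Comp_Hom[OF g'(1) f'(1)] by (auto simp: Isos_iff)
qed

lemma bij_betw_Comp_left:
  assumes "f \<in> Isos C x y"
  shows "bij_betw (\<lambda>g. f \<odot> g) (Hom C t x) (Hom C t y)"
proof -
  obtain f' where f': "f' \<in> Hom C y x" "f' \<odot> f = Id C x" "f \<odot> f' = Id C y"
    and f: "f \<in> Hom C x y" using assms by (auto simp: Isos_iff)
  show ?thesis
    by (rule bij_betw_byWitness[where f' = "\<lambda>g. f' \<odot> g"])
      (use f f' Comp_Hom in \<open>auto simp: Comp_assoc[symmetric] Id_Comp\<close>)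
qed

lemma bij_betw_Comp_right:
  assumes "f \<in> Isos C x y"
  shows "bij_betw (\<lambda>g. g \<odot> f) (Hom C y t) (Hom C x t)"
proof -
  obtain f' where f': "f' \<in> Hom C y x" "f' \<odot> f = Id C x" "f \<odot> f' = Id C y"
    and f: "f \<in> Hom C x y" using assms by (auto simp: Isos_iff)
  show ?thesis
    by (rule bij_betw_byWitness[where f' = "\<lambda>g. g \<odot> f'"])
      (use f f' Comp_Hom in \<open>auto simp: Comp_assoc Comp_Id\<close>)
qed

end

lemma (in is_functor) Ar_Isos:
  assumes "f \<in> Isos C x y"
  shows "Ar F f \<in> Isos D (Ob F x) (Ob F y)"
proof -
  obtain g where g: "g \<in> Hom C y x" "g \<odot>\<^bsub>C\<^esub> f = Id C x" "f \<odot>\<^bsub>C\<^esub> g = Id C y"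
    and f: "f \<in> Hom C x y" using assms by (auto simp: source.Isos_iff)
  have "Ar F g \<odot>\<^bsub>D\<^esub> Ar F f = Id D (Ob F x)" "Ar F f \<odot>\<^bsub>D\<^esub> Ar F g = Id D (Ob F y)"
    using Ar_Comp[OF f g(1)] Ar_Comp[OF g(1) f] g Ar_Id source.Hom_Obj[OF f] by simp_all
  then show ?thesis using Ar_Hom[OF f] Ar_Hom[OF g(1)] by (auto simp: target.Isos_iff)
qed

text \<open>The inverse is the transpose through the unit. Each round trip uses naturality of the
  unit or counit followed by one triangle identity. The counit form is the one that occurs in
  \<open>push_iso\<close>.\<close>

lemma (in adjunction) bij_betw_transpose:
  assumes x: "x \<in> Obj C" and y: "y \<in> Obj D"
  shows "bij_betw (\<lambda>f. \<epsilon> y \<odot>\<^bsub>D\<^esub> Ar F f) (Hom C x (Ob G y)) (Hom D (Ob F x) y)"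
proof (rule bij_betw_byWitness[where f' = "\<lambda>g. Ar G g \<odot>\<^bsub>C\<^esub> \<eta> x"])
  show "\<forall>f\<in>Hom C x (Ob G y). Ar G (\<epsilon> y \<odot>\<^bsub>D\<^esub> Ar F f) \<odot>\<^bsub>C\<^esub> \<eta> x = f"
  proof
    fix f assume f: "f \<in> Hom C x (Ob G y)"
    have F: "Ar F f \<in> Hom D (Ob F x) (Ob F (Ob G y))" by (rule left.Ar_Hom[OF f])
    have "Ar G (\<epsilon> y \<odot>\<^bsub>D\<^esub> Ar F f) \<odot>\<^bsub>C\<^esub> \<eta> x = (Ar G (\<epsilon> y) \<odot>\<^bsub>C\<^esub> Ar G (Ar F f)) \<odot>\<^bsub>C\<^esub> \<eta> x"
      using right.Ar_Comp[OF F counit_Hom[OF y]] by simp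
    also have "\<dots> = Ar G (\<epsilon> y) \<odot>\<^bsub>C\<^esub> (\<eta> (Ob G y) \<odot>\<^bsub>C\<^esub> f)"
      using left.source.Comp_assoc[OF unit_Hom[OF x] right.Ar_Hom[OF F]
          right.Ar_Hom[OF counit_Hom[OF y]]] unit_natural[OF f] by simp
    also have "\<dots> = f"
      using left.source.Comp_assoc[OF f unit_Hom right.Ar_Hom[OF counit_Hom[OF y]]]
        triangle_right[OF y] left.source.Id_Comp[OF f] right.Ob_Obj[OF y] by simp
    finally show "Ar G (\<epsilon> y \<odot>\<^bsub>D\<^esub> Ar F f) \<odot>\<^bsub>C\<^esub> \<eta> x = f" .
  qed
  show "\<forall>g\<in>Hom D (Ob F x) y. \<epsilon> y \<odot>\<^bsub>D\<^esub> Ar F (Ar G g \<odot>\<^bsub>C\<^esub> \<eta> x) = g"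
  proof
    fix g assume g: "g \<in> Hom D (Ob F x) y"
    have G: "Ar G g \<in> Hom C (Ob G (Ob F x)) (Ob G y)" by (rule right.Ar_Hom[OF g])
    have "\<epsilon> y \<odot>\<^bsub>D\<^esub> Ar F (Ar G g \<odot>\<^bsub>C\<^esub> \<eta> x) = \<epsilon> y \<odot>\<^bsub>D\<^esub> (Ar F (Ar G g) \<odot>\<^bsub>D\<^esub> Ar F (\<eta> x))"
      using left.Ar_Comp[OF unit_Hom[OF x] G] by simp
    also have "\<dots> = (g \<odot>\<^bsub>D\<^esub> \<epsilon> (Ob F x)) \<odot>\<^bsub>D\<^esub> Ar F (\<eta> x)"
      using left.target.Comp_assoc[OF left.Ar_Hom[OF unit_Hom[OF x]] left.Ar_Hom[OF G]
          counit_Hom[OF y]] counit_natural[OF g] by simp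
    also have "\<dots> = g"
      using left.target.Comp_assoc[OF left.Ar_Hom[OF unit_Hom[OF x]] counit_Hom g]
        triangle_left[OF x] left.target.Comp_Id[OF g] left.Ob_Obj[OF x] by simp
    finally show "\<epsilon> y \<odot>\<^bsub>D\<^esub> Ar F (Ar G g \<odot>\<^bsub>C\<^esub> \<eta> x) = g" .
  qed
  show "(\<lambda>f. \<epsilon> y \<odot>\<^bsub>D\<^esub> Ar F f) ` Hom C x (Ob G y) \<subseteq> Hom D (Ob F x) y"
    using left.target.Comp_Hom[OF left.Ar_Hom counit_Hom[OF y]] by auto
  show "(\<lambda>g. Ar G g \<odot>\<^bsub>C\<^esub> \<eta> x) ` Hom D (Ob F x) y \<subseteq> Hom C x (Ob G y)"
    using left.source.Comp_Hom[OF unit_Hom[OF x] right.Ar_Hom] by auto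
qed

section \<open>Translations in a triangulated category\<close>

context triangulated
begin

lemma shift_ob_Obj: "x \<in> Obj C \<Longrightarrow> shift_ob C n x \<in> Obj C"
  by (rule is_functor.Ob_Obj[OF additive_functor.axioms(1)[OF Shift_additive]])

lemma shift_ar_Hom: "f \<in> Hom C x y \<Longrightarrow> shift_ar C n f \<in> Hom C (shift_ob C n x) (shift_ob C n y)"
  by (rule is_functor.Ar_Hom[OF additive_functor.axioms(1)[OF Shift_additive]])

lemma shift_ar_Id: "x \<in> Obj C \<Longrightarrow> shift_ar C n (Id C x) = Id C (shift_ob C n x)"
  by (rule is_functor.Ar_Id[OF additive_functor.axioms(1)[OF Shift_additive]])

lemma shift_ar_Comp: "f \<in> Hom C x y \<Longrightarrow> g \<in> Hom C y z \<Longrightarrow>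
    shift_ar C n (g \<odot> f) = shift_ar C n g \<odot> shift_ar C n f"
  by (rule is_functor.Ar_Comp[OF additive_functor.axioms(1)[OF Shift_additive]])

lemma shift_ar_Isos:
  "f \<in> Isos C x y \<Longrightarrow> shift_ar C n f \<in> Isos C (shift_ob C n x) (shift_ob C n y)"
  by (rule is_functor.Ar_Isos[OF additive_functor.axioms(1)[OF Shift_additive]])

text \<open>Because the action of the integers is strict, \<open>[-n]\<close> strips a shift from an
  equation without inserting comparison isomorphisms.\<close>

lemma shift_ar_uminus: "f \<in> Hom C x y \<Longrightarrow> shift_ar C (- n) (shift_ar C n f) = f"
  by (simp add: Shift_add_Ar Shift_0_Ar Hom_def)

lemma shift_ob_uminus: "x \<in> Obj C \<Longrightarrow> shift_ob C (- n) (shift_ob C n x) = x"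
  by (simp add: Shift_add_Ob Shift_0_Ob)

end

section \<open>Compatibility of exact functors with all translations\<close>

context exact_functor
begin

lemma shift_iso_nat_Isos:
  "x \<in> Obj C \<Longrightarrow> shift_iso_nat C D F k x \<in>
    Isos D (Ob F (shift_ob C (int k) x)) (shift_ob D (int k) (Ob F x))"
proof (induction k)
  case 0
  then show ?case
    using target.Id_Hom[OF Ob_Obj] target.Comp_Id[OF target.Id_Hom[OF Ob_Obj]]
    by (auto simp: target.Isos_iff source.Shift_0_Ob target.Shift_0_Ob Ob_Obj)
next
  case (Suc k)
  have "ShIso F (shift_ob C (int k) x) \<in> Isos D (Ob F (shift_ob C 1 (shift_ob C (int k) x)))
      (shift_ob D 1 (Ob F (shift_ob C (int k) x)))"
    by (rule ShIso_iso[OF source.shift_ob_Obj[OF Suc.prems]])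
  from target.Comp_Isos[OF this target.shift_ar_Isos[OF Suc.IH[OF Suc.prems]]] show ?case
    using Suc.prems Ob_Obj by (simp add: source.Shift_add_Ob target.Shift_add_Ob)
qed

text \<open>For negative \<open>n\<close> the case of exponent \<open>-n\<close> is applied to
  \<open>x[n]\<close>: its source is then \<open>F x\<close> itself, and shifting by
  \<open>n\<close> and inverting gives an arrow in the required direction.\<close>

lemma shift_iso_Isos:
  assumes "x \<in> Obj C"
  shows "shift_iso C D F n x \<in> Isos D (Ob F (shift_ob C n x)) (shift_ob D n (Ob F x))"
proof (cases "0 \<le> n")
  case True
  then show ?thesis using shift_iso_nat_Isos[OF assms, of "nat n"] by (simp add: shift_iso_def)
next
  case False
  let ?x = "shift_ob C n x"
  have "shift_iso_nat C D F (nat (- n)) ?x \<in>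
      Isos D (Ob F x) (shift_ob D (- n) (Ob F ?x))"
    using shift_iso_nat_Isos[OF source.shift_ob_Obj[OF assms], of "nat (- n)" n] False
    by (simp add: source.shift_ob_uminus assms)
  then have "shift_ar D n (shift_iso_nat C D F (nat (- n)) ?x) \<in>
      Isos D (shift_ob D n (Ob F x)) (Ob F ?x)"
    using target.shift_ar_Isos[of _ _ _ n]
      target.shift_ob_uminus[OF Ob_Obj[OF source.shift_ob_Obj[OF assms]], of "- n" n]
    by fastforce
  then show ?thesis using False by (simp add: shift_iso_def target.inv_arrow_Isos)
qed

end

section \<open>Exactness\<close>

context additive_category
begin

lemma hom_group_sel [simp]:
  "carrier (hom_group C x y) = Hom C x y" "mult (hom_group C x y) = Add C"
  "one (hom_group C x y) = Zero C x y"
  by (simp_all add: hom_group_def)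

lemma Zero_Hom: "x \<in> Obj C \<Longrightarrow> y \<in> Obj C \<Longrightarrow> Zero C x y \<in> Hom C x y"
  using comm_groupE(2)[OF hom_comm_group] by simp

text \<open>Bilinearity of composition, packaged as a homomorphism so that the rules for zero
  morphisms and negatives below are instances of \<open>hom_one\<close> and
  \<open>hom_inv\<close>.\<close>

lemma group_hom_Comp_left:
  assumes "t \<in> Obj C" "f \<in> Hom C x y"
  shows "group_hom (hom_group C t x) (hom_group C t y) (\<lambda>g. f \<odot> g)"
  using assms Hom_Obj[OF assms(2)] hom_comm_group Comp_Hom Add_Comp
  by (auto simp: group_hom_def group_hom_axioms_def comm_group_def intro!: homI)

lemma group_hom_Comp_right:
  assumes "t \<in> Obj C" "f \<in> Hom C x y"
  shows "group_hom (hom_group C y t) (hom_group C x t) (\<lambda>g. g \<odot> f)"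
  using assms Hom_Obj[OF assms(2)] hom_comm_group Comp_Hom Comp_Add
  by (auto simp: group_hom_def group_hom_axioms_def comm_group_def intro!: homI)

lemma Comp_Zero: "t \<in> Obj C \<Longrightarrow> f \<in> Hom C x y \<Longrightarrow> f \<odot> Zero C t x = Zero C t y"
  using group_hom.hom_one[OF group_hom_Comp_left] by simp

lemma Zero_Comp: "t \<in> Obj C \<Longrightarrow> f \<in> Hom C x y \<Longrightarrow> Zero C y t \<odot> f = Zero C x t"
  using group_hom.hom_one[OF group_hom_Comp_right] by simp

lemma Comp_neg: "t \<in> Obj C \<Longrightarrow> f \<in> Hom C x y \<Longrightarrow> g \<in> Hom C t x \<Longrightarrow>
    f \<odot> inv\<^bsub>hom_group C t x\<^esub> g = inv\<^bsub>hom_group C t y\<^esub> (f \<odot> g)"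
  using group_hom.hom_inv[OF group_hom_Comp_left] by simp

lemma neg_Comp: "t \<in> Obj C \<Longrightarrow> f \<in> Hom C x y \<Longrightarrow> g \<in> Hom C y t \<Longrightarrow>
    inv\<^bsub>hom_group C y t\<^esub> g \<odot> f = inv\<^bsub>hom_group C x t\<^esub> (g \<odot> f)"
  using group_hom.hom_inv[OF group_hom_Comp_right] by simp

lemma neg_Hom: "f \<in> Hom C x y \<Longrightarrow> inv\<^bsub>hom_group C x y\<^esub> f \<in> Hom C x y"
  using group.inv_closed[OF comm_group.axioms(2)[OF hom_comm_group], of x y f] Hom_Obj by simp

lemma neg_inject: "f \<in> Hom C x y \<Longrightarrow> g \<in> Hom C x y \<Longrightarrow>
    inv\<^bsub>hom_group C x y\<^esub> f = inv\<^bsub>hom_group C x y\<^esub> g \<longleftrightarrow> f = g"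
  using group.inv_inj[OF comm_group.axioms(2)[OF hom_comm_group], of x y] Hom_Obj
  by (auto simp: inj_on_def)

lemma neg_Zero: "x \<in> Obj C \<Longrightarrow> y \<in> Obj C \<Longrightarrow> inv\<^bsub>hom_group C x y\<^esub> Zero C x y = Zero C x y"
  using group.is_monoid[OF comm_group.axioms(2)[OF hom_comm_group], THEN monoid.inv_one, of x y]
  by simp

end

lemma (in additive_functor) group_hom_Ar:
  assumes "x \<in> Obj C" "y \<in> Obj C"
  shows "group_hom (hom_group C x y) (hom_group D (Ob F x) (Ob F y)) (Ar F)"
  using assms source.hom_comm_group target.hom_comm_group Ob_Obj Ar_Hom Ar_Add
  by (auto simp: group_hom_def group_hom_axioms_def comm_group_def intro!: homI)

section \<open>Exactness of \<open>Hom(t, -)\<close> on distinguished triangles\<close>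

context triangulated
begin

lemma shift_ar_Zero:
  assumes "x \<in> Obj C" "y \<in> Obj C"
  shows "shift_ar C n (Zero C x y) = Zero C (shift_ob C n x) (shift_ob C n y)"
  using group_hom.hom_one[OF additive_functor.group_hom_Ar[OF Shift_additive assms]] by simp

lemma DT_rotated:
  assumes "(u, v, w) \<in> DT C" "u \<in> Hom C x y"
  shows "(v, w, inv\<^bsub>hom_group C (shift_ob C 1 x) (shift_ob C 1 y)\<^esub> (shift_ar C 1 u)) \<in> DT C"
  using DT_rotate[OF assms(2) DT_candidate[OF assms(1)]] assms(1) by blast

text \<open>The pair \<open>Id\<close>, \<open>u\<close> completes to a morphism from
  \<open>x \<rightarrow> x \<rightarrow> 0 \<rightarrow> x[1]\<close>; its middle square factors
  \<open>v \<odot> u\<close> through the zero object.\<close>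

lemma DT_Comp_zero:
  assumes "(u, v, w) \<in> DT C" "u \<in> Hom C x y" "v \<in> Hom C y z"
  shows "v \<odot> u = Zero C x z"
proof -
  obtain e where e: "zero_object C e" using ex_zero_object by blast
  have x: "x \<in> Obj C" and z: "z \<in> Obj C" and eO: "e \<in> Obj C"
    using Hom_Obj assms e by (auto simp: zero_object_def)
  have d: "Dom C u = x" "Cod C u = y" "Cod C v = z" "Dom C (Id C x) = x" "Cod C (Id C x) = x"
    "Cod C (Zero C x e) = e"
    using assms(2,3) Id_Hom[OF x] Zero_Hom[OF x eO] by (auto simp: Hom_def)
  obtain c where "triangle_morphism C (Id C x, Zero C x e, Zero C e (shift_ob C 1 x)) (u, v, w)
      (Id C x, u, c)"
    using DT_complete[OF DT_Id[OF x e] assms(1), of "Id C x" u] d Id_Hom[OF x] assms(2) by auto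
  then have c: "c \<in> Hom C e z" "c \<odot> Zero C x e = v \<odot> u"
    by (auto simp: triangle_morphism_def d)
  then show ?thesis using Comp_Zero[OF x c(1)] by simp
qed

text \<open>\<open>DT_complete\<close> supplies a third component, whereas the arrow sought is a
  first one. Rotating both triangles moves it to third place, as an arrow \<open>c\<close> from
  \<open>t[1]\<close> to \<open>x[1]\<close>, and \<open>[-1]\<close> brings it back.\<close>

lemma DT_factor:
  assumes tri: "(u, v, w) \<in> DT C" and u: "u \<in> Hom C x y" and v: "v \<in> Hom C y z"
    and g: "g \<in> Hom C t y" and zero: "v \<odot> g = Zero C t z"
  shows "\<exists>h \<in> Hom C t x. g = u \<odot> h"
proof -
  obtain e where e: "zero_object C e" using ex_zero_object by blast
  have O: "x \<in> Obj C" "y \<in> Obj C" "z \<in> Obj C" "t \<in> Obj C" "e \<in> Obj C"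
    using Hom_Obj u v g e by (auto simp: zero_object_def)
  let ?n = "\<lambda>x y f. inv\<^bsub>hom_group C (shift_ob C 1 x) (shift_ob C 1 y)\<^esub> f"
  have w: "w \<in> Hom C z (shift_ob C 1 x)"
    using DT_candidate[OF tri] u v by (auto simp: candidate_triangle_def Hom_def)
  have S: "shift_ob C 1 x \<in> Obj C" "shift_ob C 1 y \<in> Obj C" "shift_ob C 1 t \<in> Obj C"
    using O shift_ob_Obj by auto
  have d: "Dom C v = y" "Cod C v = z" "Cod C w = shift_ob C 1 x" "Dom C (Zero C t e) = t"
    "Cod C (Zero C t e) = e" "Cod C (Zero C e (shift_ob C 1 t)) = shift_ob C 1 t"
    using v w Zero_Hom[of t e] Zero_Hom[of e "shift_ob C 1 t"] O S by (auto simp: Hom_def)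
  have t1: "(Zero C t e, Zero C e (shift_ob C 1 t), ?n t t (shift_ar C 1 (Id C t))) \<in> DT C"
    by (rule DT_rotated[OF DT_Id[OF O(4) e] Id_Hom[OF O(4)]])
  have t2: "(v, w, ?n x y (shift_ar C 1 u)) \<in> DT C"
    by (rule DT_rotated[OF tri u])
  \<comment> \<open>The first square commutes because both composites from \<open>t\<close> to
    \<open>z\<close> vanish: one passes through \<open>e\<close>, the other is
    \<open>v \<odot> g\<close>.\<close>
  obtain c where "triangle_morphism C
      (Zero C t e, Zero C e (shift_ob C 1 t), ?n t t (shift_ar C 1 (Id C t)))
      (v, w, ?n x y (shift_ar C 1 u)) (g, Zero C e z, c)"
    using DT_complete[OF t1 t2, of g "Zero C e z"] d g Zero_Hom[of e z]
      Comp_Zero[of t "Zero C e z" e z] O zero by auto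
  then have c: "c \<in> Hom C (shift_ob C 1 t) (shift_ob C 1 x)"
    and eq: "shift_ar C 1 g \<odot> ?n t t (shift_ar C 1 (Id C t)) = ?n x y (shift_ar C 1 u) \<odot> c"
    by (auto simp: triangle_morphism_def d)
  have su: "shift_ar C 1 u \<in> Hom C (shift_ob C 1 x) (shift_ob C 1 y)"
    and sg: "shift_ar C 1 g \<in> Hom C (shift_ob C 1 t) (shift_ob C 1 y)"
    by (rule shift_ar_Hom[OF u], rule shift_ar_Hom[OF g])
  \<comment> \<open>Each rotation contributed one sign, so the two signs in the last square
    cancel.\<close>
  have "?n t y (shift_ar C 1 g) = ?n t y (shift_ar C 1 u \<odot> c)"
    using eq Comp_neg[OF S(3) sg Id_Hom[OF S(3)]] neg_Comp[OF S(2) c su] Comp_Id[OF sg]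
    by (simp add: shift_ar_Id[OF O(4)])
  then have "shift_ar C 1 g = shift_ar C 1 u \<odot> c"
    using neg_inject[OF sg Comp_Hom[OF c su]] by simp
  then have "shift_ar C (- 1) (shift_ar C 1 g) = shift_ar C (- 1) (shift_ar C 1 u \<odot> c)"
    by simp
  then have "g = u \<odot> shift_ar C (- 1) c"
    using shift_ar_uminus[OF g] shift_ar_uminus[OF u] shift_ar_Comp[OF c su] by simp
  moreover have "shift_ar C (- 1) c \<in> Hom C t x"
    using shift_ar_Hom[OF c, of "- 1"] shift_ob_uminus O by simp
  ultimately show ?thesis by blast
qed

text \<open>Shifting the triangle itself would introduce signs. Moving the shift to the source, from
  \<open>t\<close> to \<open>t[-n]\<close>, keeps the given triangle and its arrows.\<close>

lemma DT_factor_shift: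
  assumes tri: "(u, v, w) \<in> DT C" and u: "u \<in> Hom C x y" and v: "v \<in> Hom C y z"
    and g: "g \<in> Hom C t (shift_ob C n y)" and zero: "shift_ar C n v \<odot> g = Zero C t (shift_ob C n z)"
  shows "\<exists>h \<in> Hom C t (shift_ob C n x). g = shift_ar C n u \<odot> h"
proof -
  have O: "x \<in> Obj C" "y \<in> Obj C" "z \<in> Obj C" "t \<in> Obj C"
    using Hom_Obj u v g by auto
  have g': "shift_ar C (- n) g \<in> Hom C (shift_ob C (- n) t) y"
    using shift_ar_Hom[OF g, of "- n"] shift_ob_uminus O by simp
  have "v \<odot> shift_ar C (- n) g = shift_ar C (- n) (shift_ar C n v \<odot> g)"
    using shift_ar_Comp[OF g shift_ar_Hom[OF v]] shift_ar_uminus[OF v] by simp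
  also have "\<dots> = Zero C (shift_ob C (- n) t) z"
    using zero shift_ar_Zero[OF O(4) shift_ob_Obj[OF O(3)]] shift_ob_uminus[OF O(3)] by simp
  finally obtain h where h: "h \<in> Hom C (shift_ob C (- n) t) x" "shift_ar C (- n) g = u \<odot> h"
    using DT_factor[OF tri u v g'] by blast
  have "g = shift_ar C n (shift_ar C (- n) g)"
    using shift_ar_uminus[OF g, of "- n"] by simp
  also have "\<dots> = shift_ar C n u \<odot> shift_ar C n h"
    using h shift_ar_Comp[OF h(1) u] by simp
  finally have "g = shift_ar C n u \<odot> shift_ar C n h" .
  moreover have "shift_ar C n h \<in> Hom C t (shift_ob C n x)"
    using shift_ar_Hom[OF h(1), of n] shift_ob_uminus[OF O(4), of "- n"] by simp
  ultimately show ?thesis by blast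
qed

text \<open>The third arrow is the negative of \<open>v[1]\<close>; it is left as \<open>w'\<close>
  because exactness at \<open>x[1]\<close> is a statement about the first two arrows.\<close>

lemma DT_rotated_twice:
  assumes tri: "(u, v, w) \<in> DT C" and u: "u \<in> Hom C x y" and v: "v \<in> Hom C y z"
  obtains w' where "(w, inv\<^bsub>hom_group C (shift_ob C 1 x) (shift_ob C 1 y)\<^esub> (shift_ar C 1 u), w') \<in> DT C"
  using DT_rotated[OF DT_rotated[OF tri u] v] by blast

text \<open>Exactness at \<open>Hom(t, x[n])\<close>: two rotations put \<open>x[1]\<close> in the
  middle, and the sign acquired by \<open>u[1]\<close> does not change the kernel. Since
  \<open>w\<close> already ends in \<open>x[1]\<close>, it is shifted by \<open>n - 1\<close>
  only.\<close>

lemma image_boundary_eq_kernel: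
  assumes tri: "(u, v, w) \<in> DT C" and u: "u \<in> Hom C x y" and v: "v \<in> Hom C y z"
    and t: "t \<in> Obj C"
  shows "(\<lambda>g. shift_ar C (n - 1) w \<odot> g) ` Hom C t (shift_ob C (n - 1) z) =
    kernel (hom_group C t (shift_ob C n x)) (hom_group C t (shift_ob C n y))
      (\<lambda>g. shift_ar C n u \<odot> g)"
proof -
  have w: "w \<in> Hom C z (shift_ob C 1 x)"
    using DT_candidate[OF tri] u v by (auto simp: candidate_triangle_def Hom_def)
  have O: "x \<in> Obj C" "y \<in> Obj C" "z \<in> Obj C" "shift_ob C 1 x \<in> Obj C" "shift_ob C 1 y \<in> Obj C"
    using Hom_Obj u v shift_ob_Obj by auto
  have S: "shift_ob C (n - 1) (shift_ob C 1 x) = shift_ob C n x"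
    "shift_ob C (n - 1) (shift_ob C 1 y) = shift_ob C n y"
    "shift_ar C (n - 1) (shift_ar C 1 u) = shift_ar C n u"
    using O u by (simp_all add: Shift_add_Ob Shift_add_Ar Hom_def)
  let ?u = "inv\<^bsub>hom_group C (shift_ob C 1 x) (shift_ob C 1 y)\<^esub> (shift_ar C 1 u)"
  obtain w' where rot: "(w, ?u, w') \<in> DT C" by (rule DT_rotated_twice[OF tri u v])
  have su: "shift_ar C 1 u \<in> Hom C (shift_ob C 1 x) (shift_ob C 1 y)" by (rule shift_ar_Hom[OF u])
  have nu: "?u \<in> Hom C (shift_ob C 1 x) (shift_ob C 1 y)" by (rule neg_Hom[OF su])
  have sw: "shift_ar C (n - 1) w \<in> Hom C (shift_ob C (n - 1) z) (shift_ob C n x)"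
    using shift_ar_Hom[OF w, of "n - 1"] S by simp
  have sun: "shift_ar C n u \<in> Hom C (shift_ob C n x) (shift_ob C n y)" by (rule shift_ar_Hom[OF u])
  have snu: "shift_ar C (n - 1) ?u = inv\<^bsub>hom_group C (shift_ob C n x) (shift_ob C n y)\<^esub> (shift_ar C n u)"
    using group_hom.hom_inv[OF additive_functor.group_hom_Ar[OF Shift_additive O(4,5)], of _ "n - 1"]
      su S by simp
  \<comment> \<open>The rotated triangle gives vanishing for the negated arrow; injectivity of
    negation removes the sign.\<close>
  have "inv\<^bsub>hom_group C z (shift_ob C 1 y)\<^esub> (shift_ar C 1 u \<odot> w) =
      inv\<^bsub>hom_group C z (shift_ob C 1 y)\<^esub> Zero C z (shift_ob C 1 y)"
    using DT_Comp_zero[OF rot w nu] neg_Comp[OF O(5) w su] neg_Zero[OF O(3,5)] by simp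
  then have "shift_ar C 1 u \<odot> w = Zero C z (shift_ob C 1 y)"
    using neg_inject[OF Comp_Hom[OF w su] Zero_Hom[OF O(3,5)]] by simp
  then have uw: "shift_ar C n u \<odot> shift_ar C (n - 1) w =
      Zero C (shift_ob C (n - 1) z) (shift_ob C n y)"
    using shift_ar_Comp[OF w su, of "n - 1"] shift_ar_Zero[OF O(3,5)] S by simp
  show ?thesis
  proof (intro equalityI subsetI)
    fix h assume "h \<in> (\<lambda>g. shift_ar C (n - 1) w \<odot> g) ` Hom C t (shift_ob C (n - 1) z)"
    then obtain g where g: "g \<in> Hom C t (shift_ob C (n - 1) z)" "h = shift_ar C (n - 1) w \<odot> g"
      by blast
    then show "h \<in> kernel (hom_group C t (shift_ob C n x)) (hom_group C t (shift_ob C n y))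
      (\<lambda>g. shift_ar C n u \<odot> g)"
      using Comp_Hom[OF g(1) sw] Comp_assoc[OF g(1) sw sun] uw
        Zero_Comp[OF shift_ob_Obj[OF O(2)] g(1)] by (simp add: kernel_def)
  next
    fix g assume "g \<in> kernel (hom_group C t (shift_ob C n x)) (hom_group C t (shift_ob C n y))
      (\<lambda>g. shift_ar C n u \<odot> g)"
    then have g: "g \<in> Hom C t (shift_ob C n x)" "shift_ar C n u \<odot> g = Zero C t (shift_ob C n y)"
      by (auto simp: kernel_def)
    \<comment> \<open>Here the sign is put back, so that factorisation applies to the rotated
      triangle.\<close>
    have "shift_ar C (n - 1) ?u \<odot> g = Zero C t (shift_ob C n y)"
      using neg_Comp[OF shift_ob_Obj[OF O(2)] g(1) sun] g(2) neg_Zero[OF t shift_ob_Obj[OF O(2)]] snu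
      by simp
    then have "\<exists>h \<in> Hom C t (shift_ob C (n - 1) z). g = shift_ar C (n - 1) w \<odot> h"
      using DT_factor_shift[OF rot w nu, of g t "n - 1"] g S by simp
    then show "g \<in> (\<lambda>g. shift_ar C (n - 1) w \<odot> g) ` Hom C t (shift_ob C (n - 1) z)" by blast
  qed
qed

end

section \<open>The localisation sequence\<close>

text \<open>\<open>push_iso\<close> is a composite of additive maps: the inverse shift comparison,
  adjoint transposition and precomposition with the unit comparison of \<open>Pull K j\<close>. Each
  of these is bijective.\<close>

lemma (in coefficient_system) push_iso_group_iso:
  assumes j: "j \<in> Arr (Spaces K)" and B: "B \<in> Obj (CDom K j)"
  shows "group_hom (cohomology K (Cod (Spaces K) j) d (Ob (Push K j) B))
      (cohomology K (Dom (Spaces K) j) d B) (push_iso K j d B)"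
    and "bij_betw (push_iso K j d B)
      (carrier (cohomology K (Cod (Spaces K) j) d (Ob (Push K j) B)))
      (carrier (cohomology K (Dom (Spaces K) j) d B))"
proof -
  interpret S: space_category "Spaces K" by (rule Spaces)
  let ?C = "CCod K j" and ?D = "CDom K j"
  interpret C: triangulated ?C by (rule Coef_triangulated[OF S.Cod_Obj[OF j]])
  interpret D: triangulated ?D by (rule Coef_triangulated[OF S.Dom_Obj[OF j]])
  interpret push: exact_functor ?D ?C "Push K j" by (rule Push_exact[OF j])
  interpret pull: exact_functor ?C ?D "Pull K j" by (rule Pull_exact[OF j])
  interpret mon: symmetric_monoidal_functor ?C ?D "Pull K j" by (rule Pull_monoidal[OF j])
  interpret adj: adjunction ?C ?D "Pull K j" "Push K j" "AdjUnit K j" "AdjCounit K j"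
    by (rule Pull_Push[OF j])
  let ?Q = "shift_ob ?C d (Ob (Push K j) B)" and ?Bd = "shift_ob ?D d B"
  let ?P = "Ob (Push K j) ?Bd" and ?T = "Unit ?C"
  let ?s = "inv_arrow ?C (shift_iso ?D ?C (Push K j) d B)"
  have s: "?s \<in> Isos ?C ?Q ?P"
    by (rule C.inv_arrow_Isos[OF push.shift_iso_Isos[OF B]])
  have sH: "?s \<in> Hom ?C ?Q ?P" and mH: "MonUnit (Pull K j) \<in> Hom ?D (Unit ?D) (Ob (Pull K j) ?T)"
    using s mon.MonUnit_iso by (auto simp: Isos_def)
  have T: "?T \<in> Obj ?C" by (rule mon.source.Unit_Obj)
  have Bd: "?Bd \<in> Obj ?D" by (rule D.shift_ob_Obj[OF B])
  have P: "?P \<in> Obj ?C" by (rule push.Ob_Obj[OF Bd])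
  let ?c = "AdjCounit K j ?Bd" and ?m = "MonUnit (Pull K j)"
  \<comment> \<open>Four factors, since additivity is checked separately for the action of
    \<open>Pull K j\<close> on arrows and for composition with the counit.\<close>
  let ?f = "(\<lambda>g. g \<odot>\<^bsub>?D\<^esub> ?m) \<circ> ((\<lambda>g. ?c \<odot>\<^bsub>?D\<^esub> g) \<circ> (Ar (Pull K j) \<circ> (\<lambda>x. ?s \<odot>\<^bsub>?C\<^esub> x)))"
  have c: "?c \<in> Hom ?D (Ob (Pull K j) ?P) ?Bd" by (rule adj.counit_Hom[OF Bd])
  \<comment> \<open>The bracketings differ, and associativity is available only for composable
    arrows, so the two maps are compared on the \<open>Hom\<close> set alone.\<close>
  have eq: "push_iso K j d B x = ?f x" if x: "x \<in> Hom ?C ?T ?Q" for x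
    using D.Comp_assoc[OF mH pull.Ar_Hom[OF C.Comp_Hom[OF x sH]] c]
    by (simp add: push_iso_def)
  have "?f \<in> hom (hom_group ?C ?T ?Q) (hom_group ?D (Unit ?D) ?Bd)"
    using group_hom.homh[OF C.group_hom_Comp_left[OF T sH]]
      group_hom.homh[OF pull.group_hom_Ar[OF T P]]
      group_hom.homh[OF D.group_hom_Comp_left[OF pull.Ob_Obj[OF T] c]]
      group_hom.homh[OF D.group_hom_Comp_right[OF Bd mH]]
    by (intro hom_compose)
  then have "push_iso K j d B \<in> hom (hom_group ?C ?T ?Q) (hom_group ?D (Unit ?D) ?Bd)"
    using eq comm_groupE(1)[OF C.hom_comm_group[OF T C.Hom_Obj(1)[OF sH]]]
    by (simp add: hom_def Pi_iff del: comp_apply)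
  then show "group_hom (cohomology K (Cod (Spaces K) j) d (Ob (Push K j) B))
      (cohomology K (Dom (Spaces K) j) d B) (push_iso K j d B)"
    using C.hom_comm_group[OF T C.shift_ob_Obj[OF push.Ob_Obj[OF B]]]
      D.hom_comm_group[OF mon.target.Unit_Obj Bd]
    by (simp add: group_hom_def group_hom_axioms_def cohomology_def comm_group_def)
  \<comment> \<open>For bijectivity the two middle factors are taken together: they form the adjoint
    transposition.\<close>
  have "bij_betw ?f (Hom ?C ?T ?Q) (Hom ?D (Unit ?D) ?Bd)"
    using bij_betw_trans[OF bij_betw_trans[OF C.bij_betw_Comp_left[OF s, of ?T]
        adj.bij_betw_transpose[OF T Bd]] D.bij_betw_Comp_right[OF mon.MonUnit_iso]]
    by (simp add: comp_def)
  then show "bij_betw (push_iso K j d B)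
      (carrier (cohomology K (Cod (Spaces K) j) d (Ob (Push K j) B)))
      (carrier (cohomology K (Dom (Spaces K) j) d B))"
    using bij_betw_cong[of "Hom ?C ?T ?Q" "push_iso K j d B" ?f] eq by (simp add: cohomology_def)
qed

theorem lemma3p4:
  fixes K :: "('s, 'f, 'o, 'm) coefficients"
    and R :: "('o, 'm) recollement_data"
    and i j :: 'f and A :: 'o and \<alpha> :: 'm and d :: int
  assumes "coefficient_system K"
    and "i \<in> ClosedImm (Spaces K)"
    and "(i, j) \<in> OpenCompl (Spaces K)"
    and "recollement K i j R"
    and "A \<in> Obj (Coef K (Cod (Spaces K) i))"
    and "\<alpha> \<in> carrier (cohomology K (Cod (Spaces K) i) d A)"
    and "restriction K j d A \<alpha> = \<one>\<^bsub>cohomology K (Dom (Spaces K) j) d (Ob (Pull K j) A)\<^esub>"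
  defines "HZ \<equiv> support_cohomology K R i d A"
    and "im\<delta> \<equiv> connecting_image K R j (d - 1) A"
    and "E \<equiv> refinements K R i d A \<alpha>"
  shows "E \<noteq> {} \<and> subgroup im\<delta> HZ \<and>
    principal_homogeneous_space (HZ\<lparr>carrier := im\<delta>\<rparr>) E (translation HZ E) \<and>
    ((\<exists>!a. a \<in> E) \<longleftrightarrow> im\<delta> = {\<one>\<^bsub>HZ\<^esub>}) \<and>
    (carrier (cohomology K (Dom (Spaces K) j) (d - 1) (Ob (Pull K j) A)) =
       {\<one>\<^bsub>cohomology K (Dom (Spaces K) j) (d - 1) (Ob (Pull K j) A)\<^esub>} \<longrightarrow>
     im\<delta> = {\<one>\<^bsub>HZ\<^esub>} \<and> (\<exists>!a. a \<in> E))"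
proof -
  interpret coefficient_system K by fact
  interpret S: space_category "Spaces K" by (rule Spaces)
  \<comment> \<open>The localisation triangles are stated over the target of \<open>i\<close>,
    restriction and the connecting map over that of \<open>j\<close>; \<open>Cod\<close> identifies
    the two.\<close>
  have j: "j \<in> Arr (Spaces K)" and Cod: "Cod (Spaces K) j = Cod (Spaces K) i"
    using S.OpenCompl_Arr[OF assms(3)] by auto
  let ?C = "CCod K i" and ?D = "CDom K j"
  interpret C: triangulated ?C using Coef_triangulated[OF S.Cod_Obj[OF j]] Cod by simp
  interpret D: triangulated ?D by (rule Coef_triangulated[OF S.Dom_Obj[OF j]])
  interpret push: exact_functor ?D ?C "Push K j" using Push_exact[OF j] Cod by simp
  interpret pull: exact_functor ?C ?D "Pull K j" using Pull_exact[OF j] Cod by simp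
  interpret mon: symmetric_monoidal ?C
    using Coef_monoidal[OF S.Cod_Obj[OF j]] Cod by simp
  interpret R: recollement K i j R by fact
  interpret up: adjunction "CDom K i" ?C "Push K i" "UpShriek R" "UpUnit R" "UpCounit R"
    by (rule R.Push_UpShriek)
  interpret adj: adjunction ?C ?D "Pull K j" "Push K j" "AdjUnit K j" "AdjCounit K j"
    using R.Pull_Push_j Cod by simp
  define B where "B = Ob (Pull K j) A"
  define P where "P = Ob (Push K i) (Ob (UpShriek R) A)"
  define Q where "Q = Ob (Push K j) B"
  let ?T = "Unit ?C"
  let ?HX = "hom_group ?C ?T (shift_ob ?C d A)"
  let ?forg = "\<lambda>a. shift_ar ?C d (UpCounit R A) \<odot>\<^bsub>?C\<^esub> a"
  have A: "A \<in> Obj ?C" by fact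
  have B: "B \<in> Obj ?D" unfolding B_def by (rule pull.Ob_Obj[OF A])
  have T: "?T \<in> Obj ?C" by (rule mon.Unit_Obj)
  have u: "UpCounit R A \<in> Hom ?C P A" unfolding P_def by (rule up.counit_Hom[OF A])
  have v: "AdjUnit K j A \<in> Hom ?C A Q" unfolding Q_def B_def by (rule adj.unit_Hom[OF A])
  have tri: "(UpCounit R A, AdjUnit K j A, Bd' R A) \<in> DT ?C" by (rule R.triangle'[OF A])
  have HZ: "HZ = hom_group ?C ?T (shift_ob ?C d P)"
    by (simp add: HZ_def support_cohomology_def cohomology_def P_def)
  interpret forg: group_hom HZ ?HX ?forg
    unfolding HZ by (rule C.group_hom_Comp_left[OF T C.shift_ar_Hom[OF u]])
  have E: "E = {a \<in> carrier HZ. ?forg a = \<alpha>}"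
    by (simp add: E_def refinements_def forg_def HZ_def)
  have push: "group_hom (hom_group ?C ?T (shift_ob ?C n Q))
      (cohomology K (Dom (Spaces K) j) n B) (push_iso K j n B)"
    "bij_betw (push_iso K j n B) (Hom ?C ?T (shift_ob ?C n Q))
      (carrier (cohomology K (Dom (Spaces K) j) n B))" for n
    using push_iso_group_iso[OF j B, of n] by (simp_all add: Cod cohomology_def Q_def)

  have \<alpha>: "\<alpha> \<in> Hom ?C ?T (shift_ob ?C d A)" using assms(6) by (simp add: cohomology_def)
  \<comment> \<open>Vanishing of the restriction lives on \<open>U\<close>. As
    \<open>push_iso\<close> is injective and preserves zero, it pulls back to vanishing on
    \<open>X\<close>, where the triangle lives.\<close>
  have "shift_ar ?C d (AdjUnit K j A) \<odot>\<^bsub>?C\<^esub> \<alpha> \<in> Hom ?C ?T (shift_ob ?C d Q)"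
    by (rule C.Comp_Hom[OF \<alpha> C.shift_ar_Hom[OF v]])
  moreover have "Zero ?C ?T (shift_ob ?C d Q) \<in> Hom ?C ?T (shift_ob ?C d Q)"
    using C.Hom_Obj[OF v] by (intro C.Zero_Hom T C.shift_ob_Obj)
  moreover have "push_iso K j d B (shift_ar ?C d (AdjUnit K j A) \<odot>\<^bsub>?C\<^esub> \<alpha>) =
      push_iso K j d B (Zero ?C ?T (shift_ob ?C d Q))"
    using assms(7) group_hom.hom_one[OF push(1)[of d]] by (simp add: restriction_def B_def Cod)
  ultimately have "shift_ar ?C d (AdjUnit K j A) \<odot>\<^bsub>?C\<^esub> \<alpha> = Zero ?C ?T (shift_ob ?C d Q)"
    using bij_betw_imp_inj_on[OF push(2)[of d]] by (simp add: inj_on_def)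
  \<comment> \<open>The factorisation of \<open>\<alpha>\<close> through the shifted counit is a
    refinement.\<close>
  from C.DT_factor_shift[OF tri u v \<alpha> this] have ne: "E \<noteq> {}"
    unfolding E by (auto simp: HZ)

  let ?\<delta> = "\<lambda>g. shift_ar ?C (d - 1) (Bd' R A) \<odot>\<^bsub>?C\<^esub> g"
  let ?V = "Hom ?C ?T (shift_ob ?C (d - 1) Q)"
  let ?W = "carrier (cohomology K (Dom (Spaces K) j) (d - 1) B)"
  let ?inv = "the_inv_into ?V (push_iso K j (d - 1) B)"
  have "connecting K R j (d - 1) A b = ?\<delta> (?inv b)" for b
    by (simp add: connecting_def cohomology_def Cod Q_def B_def)
  then have "im\<delta> = ?\<delta> ` ?inv ` ?W"
    by (simp add: im\<delta>_def connecting_image_def B_def image_image)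
  \<comment> \<open>The inverse of \<open>push_iso\<close> reaches every element of
    \<open>?V\<close>, so the image of the connecting map is that of composition with the shifted
    \<open>Bd' R A\<close>.\<close>
  also have "?inv ` ?W = ?V"
    using bij_betw_the_inv_into[OF push(2)[of "d - 1"]] by (simp add: bij_betw_def)
  finally have im: "im\<delta> = ?\<delta> ` ?V" .
  also have "\<dots> = kernel HZ ?HX ?forg"
    unfolding HZ by (rule C.image_boundary_eq_kernel[OF tri u v T])
  finally have ker: "im\<delta> = kernel HZ ?HX ?forg" .
  have sub: "subgroup im\<delta> HZ" unfolding ker by (rule forg.subgroup_kernel)
  have phs: "principal_homogeneous_space (HZ\<lparr>carrier := im\<delta>\<rparr>) E (translation HZ E)"
    using principal_homogeneous_space_fibre[OF forg.group_hom_axioms] ne unfolding E ker by blast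
  have iff: "(\<exists>!a. a \<in> E) \<longleftrightarrow> im\<delta> = {\<one>\<^bsub>HZ\<^esub>}"
    using principal_homogeneous_space_ex1_iff[OF phs] by simp
  have triv: "im\<delta> = {\<one>\<^bsub>HZ\<^esub>}" if "carrier (cohomology K (Dom (Spaces K) j) (d - 1) B) =
      {\<one>\<^bsub>cohomology K (Dom (Spaces K) j) (d - 1) B\<^esub>}"
  proof -
    \<comment> \<open>The bijection makes \<open>?V\<close> a one-element set, so its image has at
      most one element; a subgroup also contains the neutral element.\<close>
    have "card im\<delta> \<le> 1"
      unfolding im using bij_betw_same_card[OF push(2)[of "d - 1"]] that
        bij_betw_finite[OF push(2)[of "d - 1"]] card_image_le[of ?V ?\<delta>] by simp
    \<comment> \<open>An infinite set has \<open>card\<close> zero, so the bound limits the elements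
      only together with finiteness.\<close>
    moreover have "finite im\<delta>"
      unfolding im using bij_betw_finite[OF push(2)[of "d - 1"]] that by simp
    ultimately show ?thesis
      using subgroup.one_closed[OF sub] by (auto simp: card_le_Suc0_iff_eq)
  qed
  show ?thesis using ne sub phs iff triv unfolding B_def by blast
qed

end
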